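(* Let $\{a_n\}_{n\geq 0}$ be the Narayana sequence, defined by $a_0=0$, $a_1=a_2=1$ and $a_n=a_{n-1}+a_{n-3}$ for $n\geq 3$. The only solutions of the equation $a_n=m!$ in positive integers $n$ and $m$ are $(n,m)\in\{(1,1),(2,1),(3,1),(4,2),(7,3)\}$. *)

theory Defs
  imports Main
begin

fun narayana :: "nat \<Rightarrow> nat" where
  "narayana 0 = 0"
| "narayana (Suc 0) = 1"
| "narayana (Suc (Suc 0)) = 1"
| "narayana (Suc (Suc (Suc n))) = narayana (Suc (Suc n)) + narayana n"

end

theory Submission
  imports Defs "HOL-Number_Theory.Cong"
begin

text \<open>
  A factorial is divisible by a large power of 2, while \<open>a\<^sub>n\<close> is not. Extended to negative
  indices, the sequence vanishes at \<open>0\<close>, \<open>-1\<close>, \<open>-3\<close>, \<open>-8\<close>, and modulo 48 it has period 56,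
  vanishing only in the residue classes of these four indices. (Modulo 16 alone there is one further
  class; the factor 3 excludes it.) If \<open>n\<close> is \<open>56 * 2 ^ i * u\<close>, \<open>u\<close> odd, away from
  one of these zeros, then \<open>2 ^ (i + 7)\<close> does not divide \<open>a\<^sub>n\<close>, so the 2-part of \<open>a\<^sub>n\<close> is
  \<open>O(n)\<close>. Since \<open>a\<^sub>n\<close> grows exponentially, \<open>a\<^sub>n = m!\<close> forces \<open>n = O(m\<^sup>2)\<close>, which is
  incompatible with the 2-part of \<open>m!\<close> once \<open>m \<ge> 20\<close>. For \<open>6 \<le> m < 20\<close> the same
  comparison works with explicit bounds for \<open>m!\<close>.
\<close>

section \<open>Solutions of the recurrence\<close>

definition narayana_rec :: "(nat \<Rightarrow> 'a::plus) \<Rightarrow> bool" where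
  "narayana_rec f \<longleftrightarrow> (\<forall>n. f (n + 3) = f (n + 2) + f n)"

lemma narayana_recD: "narayana_rec f \<Longrightarrow> f (n + 3) = f (n + 2) + f n"
  by (simp add: narayana_rec_def)

lemma narayana_rec_of_nat: "narayana_rec (\<lambda>n. of_nat (narayana n) :: 'a::semiring_1)"
  by (simp add: narayana_rec_def numeral_eq_Suc)

lemma narayana_rec_add:
  fixes f g :: "nat \<Rightarrow> 'a::ab_semigroup_add"
  assumes "narayana_rec f" "narayana_rec g"
  shows "narayana_rec (\<lambda>n. f n + g n)"
  using assms by (simp add: narayana_rec_def ac_simps)

lemma narayana_rec_mult:
  fixes f :: "nat \<Rightarrow> 'a::semiring"
  assumes "narayana_rec f"
  shows "narayana_rec (\<lambda>n. c * f n)"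
  using assms by (simp add: narayana_rec_def distrib_left)

lemma narayana_rec_shift: "narayana_rec f \<Longrightarrow> narayana_rec (\<lambda>n. f (n + k))"
  unfolding narayana_rec_def by (metis add.assoc add.commute)

lemma narayana_rec_index_add:
  fixes f :: "nat \<Rightarrow> 'a::comm_semiring_1"
  assumes "narayana_rec f"
  shows "f (n + (k + 3)) = of_nat (narayana (k + 2)) * f (n + 2)
    + of_nat (narayana k) * f (n + 1) + of_nat (narayana (k + 1)) * f n"
proof (induction k arbitrary: n)
  case 0
  show ?case using narayana_recD[OF assms, of n] by (simp add: numeral_2_eq_2)
next
  case (Suc k)
  have "narayana (Suc k + 2) = narayana (k + 2) + narayana k"
    by (simp add: numeral_2_eq_2)
  moreover have "f (Suc n + 2) = f (n + 2) + f n"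
    using narayana_recD[OF assms, of n] by (simp add: numeral_eq_Suc)
  ultimately show ?case
    using Suc[of "Suc n"] by (simp add: algebra_simps)
qed

fun narayana_table :: "nat \<Rightarrow> nat \<Rightarrow> 'a::plus \<Rightarrow> 'a \<Rightarrow> 'a \<Rightarrow> (nat \<times> 'a) list" where
  "narayana_table 0 n x y z = []"
| "narayana_table (Suc k) n x y z = (n, x) # narayana_table k (Suc n) y z (z + x)"

lemma narayana_table_eq:
  assumes "narayana_rec f"
  shows "narayana_table k n (f n) (f (n + 1)) (f (n + 2)) = map (\<lambda>i. (i, f i)) [n..<n + k]"
proof (induction k arbitrary: n)
  case (Suc k)
  have "f (Suc n + 2) = f (n + 2) + f n"
    using narayana_recD[OF assms, of n] by (simp add: numeral_eq_Suc)
  with Suc[of "Suc n"] show ?case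
    by (simp add: upt_conv_Cons del: upt_Suc)
qed simp

section \<open>Shifts by multiples of 56\<close>

lemma narayana_53_54_55:
  "narayana 53 = 262271568" "narayana 54 = 384377665" "narayana 55 = 563332848"
proof -
  have "drop 53 (narayana_table 56 0 0 1 1)
      = [(53, 262271568 :: int), (54, 384377665), (55, 563332848)]"
    by code_simp
  moreover have "narayana_table k 0 0 1 1 = map (\<lambda>i. (i, int (narayana i))) [0..<k]" for k
    using narayana_table_eq[OF narayana_rec_of_nat, of k 0] by (simp add: numeral_2_eq_2)
  ultimately have "map (\<lambda>i. (i, int (narayana i))) [53..<56]
      = [(53, 262271568), (54, 384377665), (55, 563332848)]"
    by (simp only: drop_map drop_upt add_0)
  thus "narayana 53 = 262271568" "narayana 54 = 384377665" "narayana 55 = 563332848"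
    by (simp_all add: upt_rec)
qed

text \<open>The coefficients of \<open>(x ^ 56 - 1) / 16\<close> modulo \<open>x ^ 3 - x\<^sup>2 - 1\<close>.\<close>

definition shift_quotient :: "(nat \<Rightarrow> int) \<Rightarrow> nat \<Rightarrow> int" where
  "shift_quotient f n = 24023604 * f n + 16391973 * f (n + 1) + 35208303 * f (n + 2)"

lemma narayana_rec_index_add_56:
  assumes "narayana_rec f"
  shows "f (n + 56) = f n + 16 * shift_quotient f n"
  using narayana_rec_index_add[OF assms, of n 53]
  by (simp add: narayana_53_54_55 shift_quotient_def)

lemma narayana_rec_shift_quotient:
  "narayana_rec f \<Longrightarrow> narayana_rec (shift_quotient f)"
  unfolding shift_quotient_def
  by (intro narayana_rec_add narayana_rec_mult narayana_rec_shift)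

lemma narayana_rec_mod_48:
  fixes f :: "nat \<Rightarrow> int"
  assumes "narayana_rec f"
  shows "[f n = f (n mod 56)] (mod 48)"
proof -
  have shift: "[f (n + 56) = f n] (mod 48)" for n
  proof -
    have "3 dvd shift_quotient f n"
      unfolding shift_quotient_def by (intro dvd_add dvd_mult2) simp_all
    hence "16 * 3 dvd 16 * shift_quotient f n"
      by (rule mult_dvd_mono[OF dvd_refl])
    thus ?thesis
      by (simp add: narayana_rec_index_add_56[OF assms] cong_iff_dvd_diff)
  qed
  have "[f (r + 56 * q) = f r] (mod 48)" for r q
  proof (induction q)
    case (Suc q)
    show ?case
      using cong_trans[OF shift[of "r + 56 * q"] Suc] by (simp add: ac_simps)
  qed simp
  from this[of "n mod 56" "n div 56"] show ?thesis by simp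
qed

lemma narayana_rec_index_add_56_mult:
  assumes "narayana_rec f"
  shows "\<exists>g. narayana_rec g \<and> (\<forall>n. f (n + 56 * u) = f n + 16 * g n \<and>
    [g n = int u * shift_quotient f n] (mod 8))"
proof (induction u)
  case 0
  show ?case by (intro exI[of _ "\<lambda>_. 0"]) (simp add: narayana_rec_def)
next
  case (Suc u)
  then obtain g where g: "narayana_rec g"
    and f_shift: "\<And>n. f (n + 56 * u) = f n + 16 * g n"
    and g_cong: "\<And>n. [g n = int u * shift_quotient f n] (mod 8)"
    by blast
  let ?g = "\<lambda>n. shift_quotient f n + g (n + 56)"
  have "narayana_rec ?g"
    using assms g by (intro narayana_rec_add narayana_rec_shift_quotient narayana_rec_shift)
  moreover have "f (n + 56 * Suc u) = f n + 16 * ?g n" for n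
    using f_shift[of "n + 56"] narayana_rec_index_add_56[OF assms, of n]
    by (simp add: algebra_simps)
  moreover have "[?g n = int (Suc u) * shift_quotient f n] (mod 8)" for n
  proof -
    have "[g (n + 56) = g n] (mod 8)"
      unfolding narayana_rec_index_add_56[OF g] cong_iff_dvd_diff by simp
    hence "[?g n = shift_quotient f n + int u * shift_quotient f n] (mod 8)"
      using g_cong[of n] by (intro cong_add cong_refl) (rule cong_trans)
    thus ?thesis by (simp add: distrib_right)
  qed
  ultimately show ?case by blast
qed

text \<open>The quotient \<open>g\<close> solves the recurrence again, so the claim for \<open>g\<close> itself controls
  \<open>g (n + T) - g n\<close>, the error made when the shift \<open>T\<close> is doubled.\<close>

lemma narayana_rec_index_add_56_mult_pow2:
  assumes "narayana_rec f"
  shows "\<exists>g. narayana_rec g \<and> (\<forall>n. f (n + 56 * (2 ^ i * u)) = f n + 2 ^ (i + 4) * g n \<and>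
    [g n = int u * shift_quotient f n] (mod 8))"
  using assms
proof (induction i arbitrary: f)
  case 0
  then show ?case using narayana_rec_index_add_56_mult by simp
next
  case (Suc i)
  let ?T = "56 * (2 ^ i * u)"
  from Suc obtain g where g: "narayana_rec g"
    and f_shift: "\<And>n. f (n + ?T) = f n + 2 ^ (i + 4) * g n"
    and g_cong: "\<And>n. [g n = int u * shift_quotient f n] (mod 8)"
    by blast
  from Suc.IH[OF g] obtain h where h: "narayana_rec h"
    and g_shift: "\<And>n. g (n + ?T) = g n + 2 ^ (i + 4) * h n"
    by blast
  let ?g = "\<lambda>n. g n + 2 ^ (i + 3) * h n"
  have "narayana_rec ?g"
    using g h by (intro narayana_rec_add narayana_rec_mult)
  moreover have "f (n + 56 * (2 ^ Suc i * u)) = f n + 2 ^ (Suc i + 4) * ?g n" for n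
  proof -
    have "f (n + 56 * (2 ^ Suc i * u)) = f (n + ?T + ?T)"
      by (simp add: algebra_simps)
    also have "\<dots> = f n + 2 ^ (Suc i + 4) * ?g n"
      unfolding f_shift g_shift by (simp add: power_add algebra_simps)
    finally show ?thesis .
  qed
  moreover have "[?g n = int u * shift_quotient f n] (mod 8)" for n
  proof -
    have "[?g n = g n] (mod 8)"
      by (simp add: cong_iff_dvd_diff power_add)
    thus ?thesis using g_cong cong_trans by blast
  qed
  ultimately show ?case by blast
qed

lemma narayana_rec_not_pow2_dvd:
  assumes "narayana_rec f" and "f r = 0" and "\<not> 8 dvd shift_quotient f r" and "odd u"
  shows "\<not> 2 ^ (i + 7) dvd f (r + 56 * (2 ^ i * u))"
proof
  assume dvd: "2 ^ (i + 7) dvd f (r + 56 * (2 ^ i * u))"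
  obtain g where "f (r + 56 * (2 ^ i * u)) = f r + 2 ^ (i + 4) * g r"
    and g_cong: "[g r = int u * shift_quotient f r] (mod 8)"
    using narayana_rec_index_add_56_mult_pow2[OF assms(1)] by blast
  hence "2 ^ (i + 4) * 8 dvd 2 ^ (i + 4) * g r"
    using dvd assms(2) by (simp add: power_add)
  hence "8 dvd int u * shift_quotient f r"
    using cong_dvd_iff[OF g_cong] by simp
  moreover have "coprime (2 ^ 3) (int u)"
    using assms(4) by (subst coprime_power_left_iff) simp
  ultimately show False
    using assms(3) coprime_dvd_mult_right_iff by fastforce
qed

section \<open>The power of 2 in a Narayana number\<close>

text \<open>The Narayana sequence started at index \<open>-8\<close>, its smallest zero among the four above.\<close>

fun narayana_ext :: "nat \<Rightarrow> int" where
  "narayana_ext 0 = 0"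
| "narayana_ext (Suc 0) = -2"
| "narayana_ext (Suc (Suc 0)) = 1"
| "narayana_ext (Suc (Suc (Suc n))) = narayana_ext (Suc (Suc n)) + narayana_ext n"

lemma narayana_rec_narayana_ext: "narayana_rec narayana_ext"
  by (simp add: narayana_rec_def numeral_eq_Suc)

lemma narayana_ext_add_8: "narayana_ext (n + 8) = int (narayana n)"
  by (induction n rule: narayana.induct) (simp_all add: numeral_eq_Suc)

lemma narayana_ext_dvd_48:
  assumes "48 dvd narayana_ext n"
  shows "n mod 56 \<in> {0, 5, 7, 8}"
proof -
  have "list_all (\<lambda>(i, x). 48 dvd x \<longrightarrow> i \<in> {0, 5, 7, 8}) (narayana_table 56 0 0 (-2 :: int) 1)"
    by code_simp
  moreover have "narayana_table k 0 0 (-2) 1 = map (\<lambda>i. (i, narayana_ext i)) [0..<k]" for k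
    using narayana_table_eq[OF narayana_rec_narayana_ext, of k 0] by (simp add: numeral_2_eq_2)
  ultimately have "\<forall>i<56. 48 dvd narayana_ext i \<longrightarrow> i \<in> {0, 5, 7, 8}"
    by (simp add: list_all_iff)
  moreover have "48 dvd narayana_ext (n mod 56)"
    using assms narayana_rec_mod_48[OF narayana_rec_narayana_ext] cong_dvd_iff by blast
  ultimately show ?thesis by simp
qed

lemma narayana_ext_not_pow2_dvd:
  assumes "r \<in> {0, 5, 7, 8}" and "odd u"
  shows "\<not> 2 ^ (i + 7) dvd narayana_ext (r + 56 * (2 ^ i * u))"
proof (rule narayana_rec_not_pow2_dvd[OF narayana_rec_narayana_ext _ _ assms(2)])
  show "narayana_ext r = 0" "\<not> 8 dvd shift_quotient narayana_ext r"
    using assms(1) by (auto simp: shift_quotient_def numeral_eq_Suc)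
qed

lemma narayana_dvd_48_cases:
  assumes "48 dvd narayana n" and "n > 0"
  obtains r q where "n + 8 = r + 56 * q" and "r \<in> {0, 5, 7, 8}" and "q > 0"
proof
  have "48 dvd narayana_ext (n + 8)"
    using assms(1) by (simp add: narayana_ext_add_8 flip: int_dvd_int_iff)
  thus "(n + 8) mod 56 \<in> {0, 5, 7, 8}"
    by (rule narayana_ext_dvd_48)
  thus "(n + 8) div 56 > 0"
    using assms(2) by (cases "n + 8 < 56") (auto simp: div_greater_zero_iff)
qed simp

lemma narayana_dvd_48_imp_ge:
  assumes "48 dvd narayana n" and "n > 0"
  shows "48 \<le> n"
  by (rule narayana_dvd_48_cases[OF assms]) auto

lemma narayana_pow2_dvd_imp_le:
  assumes "48 dvd narayana n" and "2 ^ k dvd narayana n" and "n > 0"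
  shows "7 * 2 ^ k \<le> 8 * (n + 8)"
proof -
  obtain r q where n: "n + 8 = r + 56 * q" and r: "r \<in> {0, 5, 7, 8}" and "q > 0"
    using narayana_dvd_48_cases assms(1,3) .
  define i where "i = multiplicity 2 q"
  obtain u where q: "q = 2 ^ i * u" and u: "odd u"
    unfolding i_def by (rule multiplicity_decompose'[of q 2]) (use \<open>q > 0\<close> in auto)
  have "2 ^ k dvd narayana_ext (n + 8)"
    using assms(2) by (simp add: narayana_ext_add_8 flip: int_dvd_int_iff)
  hence "k < i + 7"
    using narayana_ext_not_pow2_dvd[OF r u, of i] power_le_dvd unfolding n q
    by (metis not_le)
  hence "(2::nat) ^ k \<le> 2 ^ (i + 6)"
    by (intro power_increasing) auto
  also have "\<dots> \<le> 64 * q"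
    using q odd_pos[OF u] by (simp add: power_add)
  finally show ?thesis using n by simp
qed

section \<open>Growth\<close>

lemma narayana_mono: "mono narayana"
proof -
  have "narayana n \<le> narayana (Suc n)" for n
    by (cases n rule: narayana.cases) auto
  thus ?thesis by (simp add: mono_iff_le_Suc)
qed

lemma narayana_ge_pow2: "2 ^ j \<le> narayana (2 * j + 2)"
proof (induction j)
  case (Suc j)
  have "2 * narayana (Suc (Suc n)) \<le> narayana (Suc (Suc (Suc (Suc n))))" for n
    by (cases n) (simp_all add: monoD[OF narayana_mono])
  from this[of "2 * j"] Suc show ?case by simp
qed simp

lemma narayana_less_pow2_imp_index_less:
  assumes "narayana n < 2 ^ j"
  shows "n < 2 * j + 2"
proof (rule ccontr)
  assume "\<not> n < 2 * j + 2"
  hence "narayana (2 * j + 2) \<le> narayana n"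
    by (intro monoD[OF narayana_mono]) simp
  with assms narayana_ge_pow2[of j] show False by linarith
qed

lemma fact_less_pow2_square:
  assumes "m > 0"
  shows "(fact m :: nat) < 2 ^ m\<^sup>2"
proof -
  have "(fact m :: nat) \<le> m ^ m"
    using fact_le_power[of m, where ?'a = nat] by simp
  also have "\<dots> < (2 ^ m) ^ m"
    using assms by (intro power_strict_mono) auto
  finally show ?thesis by (simp add: power2_eq_square power_mult)
qed

lemma power_dvd_fact_mult:
  assumes "d > 0"
  shows "d ^ k dvd (fact (d * k) :: nat)"
proof (induction k)
  case (Suc k)
  have "d * k \<le> d * Suc k - 1" using assms by simp
  hence "d ^ k dvd (fact (d * Suc k - 1) :: nat)"
    using Suc fact_dvd dvd_trans by blast
  hence "d * d ^ k dvd (d * Suc k) * fact (d * Suc k - 1)"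
    by (intro mult_dvd_mono) simp_all
  thus ?case
    using assms fact_reduce[of "d * Suc k", where 'a = nat] by simp
qed simp

lemma quadratic_less_pow2:
  assumes "10 \<le> k"
  shows "8 * (2 * (2 * k + 1)\<^sup>2 + 9) < (7 * 2 ^ k :: nat)"
  using assms
proof (induction k rule: dec_induct)
  case (step k)
  obtain j where "k = 10 + j" using step(1) le_Suc_ex by blast
  hence "8 * (2 * (2 * Suc k + 1)\<^sup>2 + 9) \<le> 2 * (8 * (2 * (2 * k + 1)\<^sup>2 + 9))"
    by (simp add: power2_eq_square algebra_simps)
  with step show ?case by simp
qed simp

section \<open>Factorials among the Narayana numbers\<close>

lemma dvd_48_fact:
  assumes "6 \<le> m"
  shows "48 dvd (fact m :: nat)"
proof -
  have "48 dvd (fact 6 :: nat)" by (simp add: fact_numeral)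
  also have "\<dots> dvd fact m" using assms by (rule fact_dvd)
  finally show ?thesis .
qed

lemma narayana_eq_fact_imp_less_20:
  assumes "narayana n = fact m" and "n > 0"
  shows "m < 20"
proof (rule ccontr)
  assume "\<not> m < 20"
  define k where "k = m div 2"
  have k: "10 \<le> k" "2 * k \<le> m" "m \<le> 2 * k + 1"
    using \<open>\<not> m < 20\<close> by (auto simp: k_def)
  have index_less: "n < 2 * m\<^sup>2 + 2"
    using assms(1) fact_less_pow2_square[of m] \<open>\<not> m < 20\<close>
    by (intro narayana_less_pow2_imp_index_less) simp
  have "2 ^ k dvd (fact m :: nat)"
    using power_dvd_fact_mult[of 2 k] fact_dvd[OF k(2)] dvd_trans by auto
  hence "7 * 2 ^ k \<le> 8 * (n + 8)"
    using assms dvd_48_fact[of m] \<open>\<not> m < 20\<close> by (intro narayana_pow2_dvd_imp_le) simp_all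
  also have "\<dots> \<le> 8 * (2 * m\<^sup>2 + 9)"
    using index_less by simp
  also have "\<dots> \<le> 8 * (2 * (2 * k + 1)\<^sup>2 + 9)"
    using power_mono[OF k(3), of 2] by simp
  also have "\<dots> < 7 * 2 ^ k"
    using k(1) by (rule quadratic_less_pow2)
  finally show False by simp
qed

lemma narayana_eq_fact_imp_less_6:
  assumes "narayana n = fact m" and "n > 0"
  shows "m < 6"
proof (rule ccontr)
  assume "\<not> m < 6"
  hence dvd_48: "48 dvd narayana n"
    using assms(1) dvd_48_fact by simp
  have index_less: "n < 2 * j + 2" if "m \<le> l" "(fact l :: nat) < 2 ^ j" for l j
    using narayana_less_pow2_imp_index_less assms(1) fact_mono_nat[OF that(1)] that(2) by simp
  show False
  proof (cases "m < 10")
    case True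
    hence "n < 40"
      using index_less[of 9 19] by (simp add: fact_numeral)
    with narayana_dvd_48_imp_ge[OF dvd_48 assms(2)] show False by simp
  next
    case False
    have "2 ^ 8 dvd (fact 10 :: nat)" by (simp add: fact_numeral)
    hence "2 ^ 8 dvd narayana n"
      using False assms(1) fact_dvd[of 10 m] dvd_trans by force
    hence "216 \<le> n"
      using narayana_pow2_dvd_imp_le[OF dvd_48 _ assms(2)] by fastforce
    moreover have "n < 118"
      using index_less[of 19 58] narayana_eq_fact_imp_less_20[OF assms] by (simp add: fact_numeral)
    ultimately show False by simp
  qed
qed

lemma narayana_eq_fact_small:
  assumes "narayana n = fact m" and "n > 0" and "m > 0" and "m < 6"
  shows "(n, m) \<in> {(1, 1), (2, 1), (3, 1), (4, 2), (7, 3)}"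
proof -
  have "fact m \<le> (fact 5 :: nat)"
    using assms(4) by (intro fact_mono_nat) simp
  hence "n < 16"
    using assms(1) narayana_less_pow2_imp_index_less[of n 7] by (simp add: fact_numeral)
  moreover have "\<forall>n\<in>set [1..<16]. \<forall>m\<in>set [1..<6]. narayana n = fact m \<longrightarrow>
      (n, m) \<in> {(1, 1), (2, 1), (3, 1), (4, 2), (7, 3)}"
    by code_simp
  ultimately show ?thesis using assms by auto
qed

theorem theorem2:
  "{(n :: nat, m :: nat). n > 0 \<and> m > 0 \<and> narayana n = fact m}
     = {(1, 1), (2, 1), (3, 1), (4, 2), (7, 3)}"
proof (intro equalityI subrelI)
  fix n m :: nat
  assume "(n, m) \<in> {(n, m). n > 0 \<and> m > 0 \<and> narayana n = fact m}"
  hence nm: "n > 0" "m > 0" "narayana n = fact m" by simp_all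
  from narayana_eq_fact_imp_less_6[OF nm(3,1)]
  show "(n, m) \<in> {(1, 1), (2, 1), (3, 1), (4, 2), (7, 3)}"
    by (rule narayana_eq_fact_small[OF nm(3,1,2)])
next
  fix n m :: nat
  assume "(n, m) \<in> {(1, 1), (2, 1), (3, 1), (4, 2), (7, 3)}"
  thus "(n, m) \<in> {(n, m). n > 0 \<and> m > 0 \<and> narayana n = fact m}"
    by (auto simp: numeral_eq_Suc)
qed

end
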